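(* The map $w \mapsto (\mathrm{P}_{\mathrm{mTg}}(w), \mathrm{Q}_{\mathrm{mTg}}(w))$ is a bijection between the elements of $\mathbb{N}^*$ and the set formed by the pairs $\bigl((T_L,T_R),(S_L,S_R)\bigr)$ where (i) $(T_L,T_R)$ is a pair of twin BSTMs; (ii) $(S_L,S_R)$ is a pair of twin BTSs such that the union of the sets labelling $S_L$, and therefore $S_R$, is the interval $[m]$, where $m$ is the sum of the multiplicities of $T_L$ (or $T_R$); (iii) $(T_L,T_R)$ and $(S_L,S_R)$ have the same underlying pair of binary tree shapes; (iv) the multiplicity of the $i$-th node of $T_L$ (resp. $T_R$) is the cardinality of the set labelling the $i$-th node of $S_L$ (resp. $S_R$), for all $i$.
   Context: $\mathbb{N}=\{1,2,\dots\}$; $\mathbb{N}^*$ is the set of words over $\mathbb{N}$; $[m]=\{1,\dots,m\}$. Binary trees are rooted planar binary trees (left and right children distinguished); the $i$-th node of a binary tree is the $i$-th node in its inorder traversal (left subtree, root, right subtree). A binary tree with multiplicities (BTM) is a binary tree each of whose nodes carries a positive integer, its multiplicity. A binary search tree with multiplicities (BSTM) is a BTM whose nodes are further labelled by letters of $\mathbb{N}$ so that, forgetting multiplicities, it is a binary search tree with pairwise distinct letters (letters in the left subtree of a node are strictly smaller, in the right subtree strictly greater, than the letter of the node). The shape of a BSTM is the BTM obtained by forgetting the letters; $\mathrm{cont}(T)$ is the function giving for each letter its multiplicity in $T$ ($0$ if absent). Inserting a letter $a$ into a BSTM: if a node has letter $a$, increase its multiplicity by 1; otherwise add a new leaf with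 letter $a$ and multiplicity 1 in the usual binary search tree position. $\mathrm{P}^{\to}_{\mathrm{lTg}}(w)$ (resp. $\mathrm{P}^{\leftarrow}_{\mathrm{rTg}}(w)$) is the BSTM obtained from the empty tree by inserting the letters of $w$ one by one, reading $w$ left to right (resp. right to left). $\mathrm{P}_{\mathrm{mTg}}(w)=(\mathrm{P}^{\to}_{\mathrm{lTg}}(w),\mathrm{P}^{\leftarrow}_{\mathrm{rTg}}(w))$. An increasing (resp. decreasing) binary tree over sets (BTS) is a binary tree whose nodes are labelled by pairwise disjoint (nonempty finite) subsets of $\mathbb{N}$ such that, replacing each set by its minimum (resp. maximum), the label of each node is less than (resp. greater than) the labels of its children. For a word $z$ over $\mathbb{N}$ with no repeated letters, $\mathrm{incr}(z)$ (resp. $\mathrm{decr}(z)$) is the empty tree if $z$ is empty, and otherwise, writing $z=z'az''$ with $a$ the least (resp. greatest) letter of $z$, it is the binary tree with root labelled $a$, left subtree $\mathrm{incr}(z')$ and right subtree $\mathrm{incr}(z'')$ (resp. $\mathrm{decr}(z')$ and $\mathrm{decr}(z'')$). For a word $w$ with set of letters $\{x_1<\dots<x_k\}$, let $W_i$ be the set of positions of $x_i$ in $w$. $\mathrm{Q}^{\to}_{\mathrm{lTg}}(w)$ is obtained from $\mathrm{incr}(\min W_1\cdots\min W_k)$ by replacing each label $\min W_i$ by the set $W_i$; $\mathrm{Q}^{\leftarrow}_{\mathrm{rTg}}(w)$ is obtained from $\mathrm{decr}(\max W_1\cdots\max W_k)$ by replacing each label $\max W_i$ by $W_i$. $\mathrm{Q}_{\mathrm{mTg}}(w)=(\mathrm{Q}^{\to}_{\mathrm{lTg}}(w),\mathrm{Q}^{\leftarrow}_{\mathrm{rTg}}(w))$.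 A pair $(T_L,T_R)$ of BTMs with the same number of nodes is a pair of twin BTMs if for all $i$ the $i$-th nodes of $T_L$ and $T_R$ have the same multiplicity and, if the $i$-th node of $T_L$ has multiplicity 1 and has a left (resp. right) child, then the $i$-th node of $T_R$ has no left (resp. right) child. A pair of BSTMs $(T_L,T_R)$ is a pair of twin BSTMs if $\mathrm{cont}(T_L)=\mathrm{cont}(T_R)$ and their shapes form a pair of twin BTMs. A pair $(S_L,S_R)$ of an increasing BTS and a decreasing BTS, respectively, with the same number of nodes is a pair of twin BTSs if for all $i$ the $i$-th nodes of $S_L$ and $S_R$ have the same label and, if the $i$-th node of $S_L$ is labelled by a set of cardinality 1 and has a left (resp. right) child, then the $i$-th node of $S_R$ has no left (resp. right) child. *)

theory Defs
  imports Complex_Main "HOL-Library.Tree"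
begin

text \<open>
  The letters and positions of the text range over the positive integers; here they are elements
  of \<^typ>\<open>nat\<close> that are required to lie in \<open>{1..}\<close>, and positions in words count from 1.
  Nodes of trees are numbered from 0, in inorder.
\<close>

definition words :: "nat list set" where
  "words = lists {1..}"

section \<open>Nodes of binary trees\<close>

text \<open>Each node is represented by the subtree rooted at it; the nodes are listed in inorder, so
  \<open>nodes t ! i\<close> has label \<open>inorder t ! i\<close>.\<close>

fun nodes :: "'a tree \<Rightarrow> 'a tree list" where
  "nodes \<langle>\<rangle> = []"
| "nodes \<langle>l, a, r\<rangle> = nodes l @ [\<langle>l, a, r\<rangle>] @ nodes r"

definition has_left_child :: "'a tree \<Rightarrow> nat \<Rightarrow> bool" where
  "has_left_child t i \<longleftrightarrow> left (nodes t ! i) \<noteq> \<langle>\<rangle>"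

definition has_right_child :: "'a tree \<Rightarrow> nat \<Rightarrow> bool" where
  "has_right_child t i \<longleftrightarrow> right (nodes t ! i) \<noteq> \<langle>\<rangle>"

definition underlying_shape :: "'a tree \<Rightarrow> unit tree" where
  "underlying_shape t = map_tree (\<lambda>_. ()) t"

fun root_label :: "'a tree \<Rightarrow> 'a set" where
  "root_label \<langle>\<rangle> = {}"
| "root_label \<langle>l, a, r\<rangle> = {a}"

fun parent_child_wrt :: "('a \<Rightarrow> 'a \<Rightarrow> bool) \<Rightarrow> 'a tree \<Rightarrow> bool" where
  "parent_child_wrt R \<langle>\<rangle> \<longleftrightarrow> True"
| "parent_child_wrt R \<langle>l, a, r\<rangle> \<longleftrightarrow>
     (\<forall>b \<in> root_label l \<union> root_label r. R a b) \<and> parent_child_wrt R l \<and> parent_child_wrt R r"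

text \<open>The condition common to twin BTMs and twin BTSs; \<open>single\<close> singles out the labels
  (multiplicity 1, respectively cardinality 1) for which children are restricted.\<close>

definition twin_wrt :: "('a \<Rightarrow> bool) \<Rightarrow> 'a tree \<Rightarrow> 'a tree \<Rightarrow> bool" where
  "twin_wrt single L R \<longleftrightarrow> size L = size R \<and>
     (\<forall>i < size L. inorder L ! i = inorder R ! i \<and>
        (single (inorder L ! i) \<longrightarrow>
           (has_left_child L i \<longrightarrow> \<not> has_left_child R i) \<and>
           (has_right_child L i \<longrightarrow> \<not> has_right_child R i)))"

section \<open>Binary (search) trees with multiplicities\<close>

type_synonym btm = "nat tree"

text \<open>Nodes carry pairs (letter, multiplicity).\<close>

type_synonym bstm = "(nat \<times> nat) tree"

definition is_btm :: "btm \<Rightarrow> bool" where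
  "is_btm t \<longleftrightarrow> (\<forall>m \<in> set_tree t. m \<ge> 1)"

definition shape :: "bstm \<Rightarrow> btm" where
  "shape t = map_tree snd t"

definition is_bstm :: "bstm \<Rightarrow> bool" where
  "is_bstm t \<longleftrightarrow> is_btm (shape t) \<and> set_tree (map_tree fst t) \<subseteq> {1..} \<and> bst (map_tree fst t)"

definition cont :: "bstm \<Rightarrow> nat \<Rightarrow> nat" where
  "cont t a = (case map_of (inorder t) a of None \<Rightarrow> 0 | Some m \<Rightarrow> m)"

definition sum_mult :: "bstm \<Rightarrow> nat" where
  "sum_mult t = sum_list (map snd (inorder t))"

fun insert_letter :: "nat \<Rightarrow> bstm \<Rightarrow> bstm" where
  "insert_letter a \<langle>\<rangle> = \<langle>\<langle>\<rangle>, (a, 1), \<langle>\<rangle>\<rangle>"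
| "insert_letter a \<langle>l, (b, m), r\<rangle> =
     (if a = b then \<langle>l, (b, m + 1), r\<rangle>
      else if a < b then \<langle>insert_letter a l, (b, m), r\<rangle>
      else \<langle>l, (b, m), insert_letter a r\<rangle>)"

definition P_lTg :: "nat list \<Rightarrow> bstm" where
  "P_lTg w = fold insert_letter w \<langle>\<rangle>"

text \<open>\<^const>\<open>foldr\<close> inserts the last letter of \<open>w\<close> first.\<close>

definition P_rTg :: "nat list \<Rightarrow> bstm" where
  "P_rTg w = foldr insert_letter w \<langle>\<rangle>"

definition P_mTg :: "nat list \<Rightarrow> bstm \<times> bstm" where
  "P_mTg w = (P_lTg w, P_rTg w)"

definition twin_btms :: "btm \<Rightarrow> btm \<Rightarrow> bool" where
  "twin_btms TL TR \<longleftrightarrow> is_btm TL \<and> is_btm TR \<and> twin_wrt (\<lambda>m. m = 1) TL TR"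

definition twin_bstms :: "bstm \<Rightarrow> bstm \<Rightarrow> bool" where
  "twin_bstms TL TR \<longleftrightarrow>
     is_bstm TL \<and> is_bstm TR \<and> cont TL = cont TR \<and> twin_btms (shape TL) (shape TR)"

section \<open>Binary trees over sets\<close>

type_synonym bts = "nat set tree"

definition is_bts :: "bts \<Rightarrow> bool" where
  "is_bts t \<longleftrightarrow> (\<forall>X \<in> set_tree t. finite X \<and> X \<noteq> {} \<and> X \<subseteq> {1..}) \<and>
     (\<forall>i < size t. \<forall>j < size t. i \<noteq> j \<longrightarrow> inorder t ! i \<inter> inorder t ! j = {})"

definition increasing_bts :: "bts \<Rightarrow> bool" where
  "increasing_bts t \<longleftrightarrow> is_bts t \<and> parent_child_wrt (<) (map_tree Min t)"

definition decreasing_bts :: "bts \<Rightarrow> bool" where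
  "decreasing_bts t \<longleftrightarrow> is_bts t \<and> parent_child_wrt (>) (map_tree Max t)"

lemma length_takeWhile_less:
  assumes "\<exists>x \<in> set xs. \<not> P x"
  shows "length (takeWhile P xs) < length xs"
  using assms by (induction xs) auto

text \<open>Only meant for words without repeated letters.\<close>

function incr :: "nat list \<Rightarrow> nat tree" where
  "incr z =
     (if z = [] then \<langle>\<rangle>
      else \<langle>incr (takeWhile (\<lambda>x. x \<noteq> Min (set z)) z), Min (set z),
            incr (tl (dropWhile (\<lambda>x. x \<noteq> Min (set z)) z))\<rangle>)"
  by pat_completeness auto
termination
proof (relation "measure length")
  fix z :: "nat list" assume z: "z \<noteq> []"
  have "\<exists>x \<in> set z. \<not> x \<noteq> Min (set z)" using z by auto
  then show "(takeWhile (\<lambda>x. x \<noteq> Min (set z)) z, z) \<in> measure length"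
    using length_takeWhile_less[of z "\<lambda>x. x \<noteq> Min (set z)"] by simp
  have "length z > 0" using z by simp
  then show "(tl (dropWhile (\<lambda>x. x \<noteq> Min (set z)) z), z) \<in> measure length"
    using length_dropWhile_le[of "\<lambda>x. x \<noteq> Min (set z)" z] unfolding in_measure length_tl
    by linarith
qed simp

function decr :: "nat list \<Rightarrow> nat tree" where
  "decr z =
     (if z = [] then \<langle>\<rangle>
      else \<langle>decr (takeWhile (\<lambda>x. x \<noteq> Max (set z)) z), Max (set z),
            decr (tl (dropWhile (\<lambda>x. x \<noteq> Max (set z)) z))\<rangle>)"
  by pat_completeness auto
termination
proof (relation "measure length")
  fix z :: "nat list" assume z: "z \<noteq> []"
  have "\<exists>x \<in> set z. \<not> x \<noteq> Max (set z)" using z by auto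
  then show "(takeWhile (\<lambda>x. x \<noteq> Max (set z)) z, z) \<in> measure length"
    using length_takeWhile_less[of z "\<lambda>x. x \<noteq> Max (set z)"] by simp
  have "length z > 0" using z by simp
  then show "(tl (dropWhile (\<lambda>x. x \<noteq> Max (set z)) z), z) \<in> measure length"
    using length_dropWhile_le[of "\<lambda>x. x \<noteq> Max (set z)" z] unfolding in_measure length_tl
    by linarith
qed simp

text \<open>The defining equations loop as simplification rules.\<close>

declare incr.simps [simp del] decr.simps [simp del]

definition positions :: "nat list \<Rightarrow> nat \<Rightarrow> nat set" where
  "positions w x = {p \<in> {1..length w}. w ! (p - 1) = x}"

text \<open>The label \<open>p\<close>, being the least (or greatest) position of some letter \<open>x\<close>, is replaced by the
  set of positions of \<open>x\<close>; this \<open>x\<close> is the letter at position \<open>p\<close>.\<close>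

definition position_labels :: "nat list \<Rightarrow> nat tree \<Rightarrow> bts" where
  "position_labels w t = map_tree (\<lambda>p. positions w (w ! (p - 1))) t"

definition Q_lTg :: "nat list \<Rightarrow> bts" where
  "Q_lTg w = position_labels w
     (incr (map (\<lambda>x. Min (positions w x)) (sorted_list_of_set (set w))))"

definition Q_rTg :: "nat list \<Rightarrow> bts" where
  "Q_rTg w = position_labels w
     (decr (map (\<lambda>x. Max (positions w x)) (sorted_list_of_set (set w))))"

definition Q_mTg :: "nat list \<Rightarrow> bts \<times> bts" where
  "Q_mTg w = (Q_lTg w, Q_rTg w)"

definition twin_btss :: "bts \<Rightarrow> bts \<Rightarrow> bool" where
  "twin_btss SL SR \<longleftrightarrow>
     increasing_bts SL \<and> decreasing_bts SR \<and> twin_wrt (\<lambda>X. card X = 1) SL SR"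

end

(*
  Forgetting multiplicities, the left tree of a word w is the unique binary search tree on the
  letters of w that is heap-ordered by first occurrence, the right tree the one heap-ordered by
  decreasing last occurrence. Replacing each letter by its multiplicity or by its set of positions
  turns these two trees into P and Q. Hence w is recovered from the letters in P and the position
  sets in Q, and conversely any admissible letters and position sets determine a word whose trees
  are the given ones, by uniqueness of heap-ordered trees.

  In a heap-ordered tree a node has a left (right) child only if it precedes its inorder
  predecessor (successor) in the heap order. For a letter occurring once, first and last
  occurrence coincide, so having that child in both trees would place the neighbouring letter's
  first occurrence after its last one: the twin condition holds automatically.
*)

theory Submission
  imports Defs
begin

section \<open>Heap-ordered trees\<close>

lemma root_label_subset: "root_label t \<subseteq> set_tree t"
  by (cases t) auto

lemma root_label_map_tree: "root_label (map_tree f t) = f ` root_label t"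
  by (cases t) auto

text \<open>The implication is required only between labels of \<open>t\<close>. This allows
  priorities to be changed or reversed, and, with an identity map, to be traded for a relation on
  the labels themselves.\<close>

lemma parent_child_wrt_mono:
  assumes "parent_child_wrt R (map_tree f t)"
    and mono: "\<And>a b. a \<in> set_tree t \<Longrightarrow> b \<in> set_tree t \<Longrightarrow> R (f a) (f b) \<Longrightarrow> S (g a) (g b)"
  shows "parent_child_wrt S (map_tree g t)"
proof -
  have "parent_child_wrt S (map_tree g u)"
    if "parent_child_wrt R (map_tree f u)" "set_tree u \<subseteq> set_tree t" for u
    using that
  proof (induction u)
    case Leaf
    then show ?case by simp
  next
    case (Node l a r)
    have "S (g a) (g b)" if "b \<in> root_label l \<union> root_label r" for b
      using that Node.prems root_label_subset[of l] root_label_subset[of r]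
      by (intro mono) (auto simp: root_label_map_tree)
    then show ?case using Node by (auto simp: root_label_map_tree)
  qed
  then show ?thesis using assms(1) by simp
qed

text \<open>Transitivity carries the relation down the path from the root: \<open>x\<close> is the
  root of a child or a proper descendant of that root.\<close>

lemma parent_child_wrt_descendant:
  assumes "parent_child_wrt R \<langle>l, a, r\<rangle>" "transp R" "x \<in> set_tree l \<union> set_tree r"
  shows "R a x"
  using assms(1,3)
proof (induction "\<langle>l, a, r\<rangle>" arbitrary: l a r rule: measure_induct_rule[where f = size])
  case less
  then obtain s where s: "s = l \<or> s = r" "x \<in> set_tree s" by auto
  then obtain l' b r' where s': "s = \<langle>l', b, r'\<rangle>" by (cases s) auto
  have ab: "R a b" "parent_child_wrt R s" using less.prems(1) s(1) s' by auto
  show ?case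
  proof (cases "x = b")
    case False
    have "size s < size \<langle>l, a, r\<rangle>" using s(1) by auto
    then have "R b x" using less.hyps[of l' b r'] ab(2) s(2) s' False by auto
    then show ?thesis using transpD[OF assms(2) ab(1)] by blast
  qed (use ab in simp)
qed

text \<open>Both roots must be the \<open>R\<close>-first label: were they different, each would lie
  below the other. By irreflexivity that label occurs only once, so it cuts the inorder list in only
  one way.\<close>

lemma heap_unique:
  assumes "parent_child_wrt R t" "parent_child_wrt R u" "inorder t = inorder u"
    and R: "transp R" "asymp R"
  shows "t = u"
  using assms(1-3)
proof (induction t arbitrary: u)
  case Leaf
  then show ?case by (cases u) auto
next
  case (Node l a r)
  obtain l' b r' where u: "u = \<langle>l', b, r'\<rangle>" using Node.prems(3) by (cases u) auto
  have a: "R a x" if "x \<in> set_tree l \<union> set_tree r" for x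
    using parent_child_wrt_descendant[OF Node.prems(1) R(1) that] .
  have b: "R b x" if "x \<in> set_tree l' \<union> set_tree r'" for x
    using parent_child_wrt_descendant[OF Node.prems(2)[unfolded u] R(1) that] .
  have irrefl: "\<not> R x x" for x using asympD[OF R(2)] by blast
  have "set_tree \<langle>l, a, r\<rangle> = set_tree u"
    using Node.prems(3) by (metis set_inorder)
  then have "a = b \<or> a \<in> set_tree l' \<union> set_tree r'" "a = b \<or> b \<in> set_tree l \<union> set_tree r"
    unfolding u by auto
  then have ab: "a = b"
    using a[of b] b[of a] asympD[OF R(2), of a b] by blast
  have "a \<notin> set_tree l" "a \<notin> set_tree r"
    using a[of a] irrefl[of a] by blast+
  then have "inorder l = inorder l' \<and> inorder r = inorder r'"
    using Node.prems(3) append_Cons_eq_iff[of a "inorder l" "inorder r" "inorder l'" "inorder r'"]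
    by (simp add: u ab)
  then show ?case using Node.IH(1)[of l'] Node.IH(2)[of r'] Node.prems(1,2) by (simp add: u ab)
qed

lemma bst_heap_unique:
  fixes f :: "'a::linorder \<Rightarrow> 'b::linorder"
  assumes "bst t" "bst u" "set_tree t = set_tree u"
    and "parent_child_wrt (<) (map_tree f t)" "parent_child_wrt (<) (map_tree f u)"
  shows "t = u"
proof (rule heap_unique[where R = "\<lambda>a b. f a < f b"])
  show "inorder t = inorder u"
    using assms(1-3) by (intro strict_sorted_equal) (simp_all add: bst_iff_sorted_wrt_less)
  \<comment> \<open>Labelling by the identity gives the form of
    \<open>parent_child_wrt_mono\<close>, which moves the comparison from the values of
    \<open>f\<close> to the labels of \<open>v\<close>.\<close>
  have "parent_child_wrt (\<lambda>a b. f a < f b) (map_tree (\<lambda>x. x) v)"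
    if "parent_child_wrt (<) (map_tree f v)" for v
    using that by (rule parent_child_wrt_mono)
  then show "parent_child_wrt (\<lambda>a b. f a < f b) t" "parent_child_wrt (\<lambda>a b. f a < f b) u"
    using assms(4,5) by (simp_all only: tree.map_ident)
qed (auto intro!: transpI asympI)

section \<open>Children and inorder neighbours\<close>

lemma length_nodes [simp]: "length (nodes t) = size t"
  by (induction t) auto

lemma nodes_map_tree: "nodes (map_tree f t) = map (map_tree f) (nodes t)"
  by (induction t) auto

lemma has_child_map_tree [simp]:
  assumes "i < size t"
  shows "has_left_child (map_tree f t) i = has_left_child t i"
    and "has_right_child (map_tree f t) i = has_right_child t i"
proof -
  have "left (map_tree f s) = map_tree f (left s)" "right (map_tree f s) = map_tree f (right s)"
    for s by (cases s; simp)+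
  then show "has_left_child (map_tree f t) i = has_left_child t i"
    "has_right_child (map_tree f t) i = has_right_child t i"
    using assms by (simp_all add: has_left_child_def has_right_child_def nodes_map_tree)
qed

text \<open>The inorder predecessor of a node with a left child is the last node of its left
  subtree, hence a descendant.\<close>

lemma has_left_child_heap:
  assumes "parent_child_wrt R t" "transp R" "i < size t" "has_left_child t i"
  shows "0 < i \<and> R (inorder t ! i) (inorder t ! (i - 1))"
  using assms(1,3,4)
proof (induction t arbitrary: i)
  case Leaf
  then show ?case by simp
next
  case (Node l a r)
  consider "i < size l" | "i = size l" | "i > size l" by linarith
  then show ?case
  proof cases
    case 1
    then have "has_left_child l i"
      using Node.prems(3) by (simp add: has_left_child_def nth_append)
    then show ?thesis
      using Node.IH(1)[of i] Node.prems(1) 1 by (auto simp: nth_append)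
  next
    case 2
    then have "l \<noteq> \<langle>\<rangle>"
      using Node.prems(3) by (simp add: has_left_child_def nth_append)
    then have i: "0 < i" using 2 by (cases l) auto
    have "inorder l ! (i - 1) \<in> set_tree l"
      using nth_mem[of "i - 1" "inorder l"] 2 i by simp
    then show ?thesis
      using parent_child_wrt_descendant[OF Node.prems(1) assms(2)] 2 i by (simp add: nth_append)
  next
    case 3
    then obtain j where j: "i = Suc (size l + j)" using less_iff_Suc_add by blast
    have "has_left_child r j"
      using Node.prems(3) by (simp add: has_left_child_def nth_append j)
    then have IH: "0 < j \<and> R (inorder r ! j) (inorder r ! (j - 1))"
      using Node.IH(2)[of j] Node.prems(1,2) j by simp
    \<comment> \<open>As \<open>j\<close> is positive, the predecessor of the node still lies in
      \<open>r\<close>.\<close>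
    then obtain k where "j = Suc k" using gr0_conv_Suc by blast
    then show ?thesis using IH by (simp add: nth_append j)
  qed
qed

text \<open>Symmetrically, the inorder successor is the first node of the right subtree.\<close>

lemma has_right_child_heap:
  assumes "parent_child_wrt R t" "transp R" "i < size t" "has_right_child t i"
  shows "Suc i < size t \<and> R (inorder t ! i) (inorder t ! Suc i)"
  using assms(1,3,4)
proof (induction t arbitrary: i)
  case Leaf
  then show ?case by simp
next
  case (Node l a r)
  consider "i < size l" | "i = size l" | "i > size l" by linarith
  then show ?case
  proof cases
    case 1
    then have "has_right_child l i"
      using Node.prems(3) by (simp add: has_right_child_def nth_append)
    then show ?thesis
      using Node.IH(1)[of i] Node.prems(1) 1 by (simp add: nth_append)
  next
    case 2
    then have r: "r \<noteq> \<langle>\<rangle>"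
      using Node.prems(3) by (simp add: has_right_child_def nth_append)
    then have s: "0 < size r" by (cases r) auto
    have "inorder r ! 0 \<in> set_tree r"
      using nth_mem[of 0 "inorder r"] s by simp
    then show ?thesis
      using parent_child_wrt_descendant[OF Node.prems(1) assms(2)] 2 s by (simp add: nth_append)
  next
    case 3
    then obtain j where j: "i = Suc (size l + j)" using less_iff_Suc_add by blast
    have "has_right_child r j"
      using Node.prems(3) by (simp add: has_right_child_def nth_append j)
    then show ?thesis
      using Node.IH(2)[of j] Node.prems(1,2) j by (simp add: nth_append)
  qed
qed

text \<open>\<open>lo\<close> and \<open>hi\<close> stand for first and last position and
  \<open>f\<close> for the final label, so that multiplicities and position sets are covered
  together.\<close>

lemma twin_wrt_map_tree:
  fixes lo hi :: "'a \<Rightarrow> 'b::linorder"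
  assumes inorder: "inorder L = inorder R"
    and L: "parent_child_wrt (<) (map_tree lo L)"
    and R: "parent_child_wrt (>) (map_tree hi R)"
    and le: "\<And>x. x \<in> set_tree L \<Longrightarrow> lo x \<le> hi x"
    and single: "\<And>x. x \<in> set_tree L \<Longrightarrow> single (f x) \<Longrightarrow> lo x = hi x"
  shows "twin_wrt single (map_tree f L) (map_tree f R)"
proof -
  have size: "size L = size R" using inorder by (metis length_inorder)
  have mem: "inorder L ! i \<in> set_tree L" if "i < size L" for i
    using nth_mem[of i "inorder L"] that by simp
  have trans: "transp ((<) :: 'b \<Rightarrow> 'b \<Rightarrow> bool)" "transp ((>) :: 'b \<Rightarrow> 'b \<Rightarrow> bool)"
    by (auto intro: transpI)
  have "\<not> has_left_child R i"
    if i: "i < size L" and s: "single (f (inorder L ! i))" and c: "has_left_child L i" for i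
  proof
    assume c': "has_left_child R i"
    have "0 < i \<and> lo (inorder L ! i) < lo (inorder L ! (i - 1))"
      using has_left_child_heap[OF L trans(1), of i] i c by (simp add: inorder_map)
    moreover have "hi (inorder L ! (i - 1)) < hi (inorder L ! i)"
      using has_left_child_heap[OF R trans(2), of i] i c' size by (simp add: inorder_map inorder)
    \<comment> \<open>With \<open>x\<close> the label of the node and \<open>y\<close> that of its
      predecessor: \<open>hi y < hi x = lo x < lo y <= hi y\<close>.\<close>
    ultimately show False
      using single[OF mem[OF i] s] le[OF mem[of "i - 1"]] i by fastforce
  qed
  moreover have "\<not> has_right_child R i"
    if i: "i < size L" and s: "single (f (inorder L ! i))" and c: "has_right_child L i" for i
  proof
    assume c': "has_right_child R i"
    have "Suc i < size L \<and> lo (inorder L ! i) < lo (inorder L ! Suc i)"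
      using has_right_child_heap[OF L trans(1), of i] i c by (auto simp: inorder_map)
    moreover have "hi (inorder L ! Suc i) < hi (inorder L ! i)"
      using has_right_child_heap[OF R trans(2), of i] i c' size by (auto simp: inorder_map inorder)
    ultimately show False
      using single[OF mem[OF i] s] le[OF mem[of "Suc i"]] by auto
  qed
  ultimately show ?thesis
    using size by (auto simp: twin_wrt_def inorder_map inorder)
qed

section \<open>The recursive trees \<open>incr\<close> and \<open>decr\<close>\<close>

lemma takeWhile_neq_Cons_tl_dropWhile:
  assumes "a \<in> set z"
  shows "takeWhile (\<lambda>x. x \<noteq> a) z @ a # tl (dropWhile (\<lambda>x. x \<noteq> a) z) = z"
proof -
  have "dropWhile (\<lambda>x. x \<noteq> a) z \<noteq> []" "hd (dropWhile (\<lambda>x. x \<noteq> a) z) = a"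
    using assms hd_dropWhile[of "\<lambda>x. x \<noteq> a" z] by (auto simp: dropWhile_eq_Nil_conv)
  then have "a # tl (dropWhile (\<lambda>x. x \<noteq> a) z) = dropWhile (\<lambda>x. x \<noteq> a) z"
    by (metis list.collapse)
  then show ?thesis by simp
qed

text \<open>By \<open>heap_unique\<close> these two properties determine \<open>incr z\<close>, so
  they can stand in for the recursive equation from here on. Distinctness makes the least letter
  strictly smaller than the letters on either side.\<close>

lemma incr_heap:
  assumes "distinct z"
  shows "inorder (incr z) = z \<and> parent_child_wrt (<) (incr z)"
  using assms
proof (induction z rule: incr.induct)
  case (1 z)
  show ?case
  proof (cases "z = []")
    case True
    then show ?thesis by (simp add: incr.simps)
  next
    case False
    define a where "a = Min (set z)"
    define l where "l = takeWhile (\<lambda>x. x \<noteq> a) z"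
    define r where "r = tl (dropWhile (\<lambda>x. x \<noteq> a) z)"
    have z: "z = l @ a # r"
      using takeWhile_neq_Cons_tl_dropWhile[of a z] False by (simp add: a_def l_def r_def)
    have "distinct l" "distinct r" using "1.prems" unfolding z by auto
    then have IH: "inorder (incr l) = l" "parent_child_wrt (<) (incr l)"
      "inorder (incr r) = r" "parent_child_wrt (<) (incr r)"
      using "1.IH"[OF False, folded a_def, folded l_def r_def] by auto
    have "a < x" if "x \<in> set l \<union> set r" for x
    proof -
      have "x \<in> set z" "x \<noteq> a" using that "1.prems" unfolding z by auto
      then show ?thesis using Min_le[of "set z" x] by (simp add: a_def order_less_le)
    qed
    then have "a < x" if "x \<in> root_label (incr l) \<union> root_label (incr r)" for x
      using that IH(1,3) root_label_subset by (metis UnE UnI1 UnI2 set_inorder subsetD)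
    moreover have "incr z = \<langle>incr l, a, incr r\<rangle>"
      using False by (subst incr.simps) (simp add: a_def l_def r_def)
    ultimately show ?thesis using IH z by auto
  qed
qed

lemma decr_heap:
  assumes "distinct z"
  shows "inorder (decr z) = z \<and> parent_child_wrt (>) (decr z)"
  using assms
proof (induction z rule: decr.induct)
  case (1 z)
  show ?case
  proof (cases "z = []")
    case True
    then show ?thesis by (simp add: decr.simps)
  next
    case False
    define a where "a = Max (set z)"
    define l where "l = takeWhile (\<lambda>x. x \<noteq> a) z"
    define r where "r = tl (dropWhile (\<lambda>x. x \<noteq> a) z)"
    have z: "z = l @ a # r"
      using takeWhile_neq_Cons_tl_dropWhile[of a z] False by (simp add: a_def l_def r_def)
    have "distinct l" "distinct r" using "1.prems" unfolding z by auto
    then have IH: "inorder (decr l) = l" "parent_child_wrt (>) (decr l)"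
      "inorder (decr r) = r" "parent_child_wrt (>) (decr r)"
      using "1.IH"[OF False, folded a_def, folded l_def r_def] by auto
    have "a > x" if "x \<in> set l \<union> set r" for x
    proof -
      have "x \<in> set z" "x \<noteq> a" using that "1.prems" unfolding z by auto
      then show ?thesis using Max_ge[of "set z" x] by (simp add: a_def order_less_le)
    qed
    then have "a > x" if "x \<in> root_label (decr l) \<union> root_label (decr r)" for x
      using that IH(1,3) root_label_subset by (metis UnE UnI1 UnI2 set_inorder subsetD)
    moreover have "decr z = \<langle>decr l, a, decr r\<rangle>"
      using False by (subst decr.simps) (simp add: a_def l_def r_def)
    ultimately show ?thesis using IH z by auto
  qed
qed

text \<open>The shape gives the size of each left subtree, hence the place where the inorder list is
  cut.\<close>

lemma tree_eq_if_shape_inorder: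
  assumes "underlying_shape t = underlying_shape u" "inorder t = inorder u"
  shows "t = u"
  using assms
proof (induction t arbitrary: u)
  case Leaf
  then show ?case by (cases u) auto
next
  case (Node l a r)
  obtain l' b r' where u: "u = \<langle>l', b, r'\<rangle>"
    using Node.prems(2) by (cases u) auto
  have s: "underlying_shape l = underlying_shape l'" "underlying_shape r = underlying_shape r'"
    using Node.prems(1) by (simp_all add: u underlying_shape_def)
  have "length (inorder l) = length (inorder l')"
    using s(1) by (metis length_inorder size_map_tree underlying_shape_def)
  then show ?case
    using Node.prems(2) Node.IH(1)[of l'] Node.IH(2)[of r'] s by (simp add: u)
qed

lemma underlying_shape_map_tree [simp]: "underlying_shape (map_tree f t) = underlying_shape t"
  by (simp add: underlying_shape_def tree.map_comp comp_def)

section \<open>Positions of letters\<close>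

lemma finite_positions [simp]: "finite (positions w x)"
  by (simp add: positions_def)

lemma positions_empty_iff [simp]: "positions w x = {} \<longleftrightarrow> x \<notin> set w"
proof -
  have "Suc i \<in> positions w (w ! i)" if "i < length w" for i
    using that by (simp add: positions_def)
  moreover have "x \<in> set w" if "p \<in> positions w x" for p
    using that by (auto simp: positions_def)
  ultimately show ?thesis by (metis all_not_in_conv in_set_conv_nth)
qed

lemma nth_Min_positions:
  assumes "x \<in> set w"
  shows "w ! (Min (positions w x) - 1) = x"
proof -
  have "Min (positions w x) \<in> positions w x" using assms by (intro Min_in) auto
  then show ?thesis unfolding positions_def[of w x] mem_Collect_eq by blast
qed

lemma nth_Max_positions:
  assumes "x \<in> set w"
  shows "w ! (Max (positions w x) - 1) = x"
proof -
  have "Max (positions w x) \<in> positions w x" using assms by (intro Max_in) auto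
  then show ?thesis unfolding positions_def[of w x] mem_Collect_eq by blast
qed

lemma inj_on_Min_positions: "inj_on (\<lambda>x. Min (positions w x)) (set w)"
  by (metis (no_types, lifting) inj_onI nth_Min_positions)

lemma inj_on_Max_positions: "inj_on (\<lambda>x. Max (positions w x)) (set w)"
  by (metis (no_types, lifting) inj_onI nth_Max_positions)

text \<open>Appending a letter keeps the old positions in place, which is why inductions on words
  proceed from the right end.\<close>

lemma positions_snoc:
  "positions (w @ [a]) x = positions w x \<union> (if x = a then {Suc (length w)} else {})"
proof -
  have "(w @ [a]) ! (p - 1) = (if p = Suc (length w) then a else w ! (p - 1))"
    if "1 \<le> p" "p \<le> Suc (length w)" for p
    using that by (auto simp: nth_append)
  then show ?thesis
    unfolding positions_def by (auto simp: le_Suc_eq)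
qed

lemma card_positions: "card (positions w x) = count_list w x"
proof (induction w rule: rev_induct)
  case Nil
  then show ?case by (simp add: positions_def)
next
  case (snoc a w)
  have "Suc (length w) \<notin> positions w x" by (simp add: positions_def)
  then show ?case using snoc by (simp add: positions_snoc)
qed

lemma Min_positions_le:
  assumes "x \<in> set w"
  shows "Min (positions w x) \<le> length w"
proof -
  have "Min (positions w x) \<in> positions w x" using assms by (intro Min_in) auto
  then show ?thesis unfolding positions_def[of w x] by simp
qed

lemma Min_positions_snoc_old:
  assumes "x \<in> set w"
  shows "Min (positions (w @ [a]) x) = Min (positions w x)"
  using assms Min_positions_le[OF assms]
  by (cases "x = a") (simp_all add: positions_snoc)

lemma Min_positions_snoc_new:
  assumes "a \<notin> set w"
  shows "Min (positions (w @ [a]) a) = Suc (length w)"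
proof -
  have "positions w a = {}" using assms by simp
  then show ?thesis by (simp only: positions_snoc) simp
qed

lemma Min_le_Max_positions:
  assumes "x \<in> set w"
  shows "Min (positions w x) \<le> Max (positions w x)"
  using assms by (intro Min_le Max_in) auto

lemma Min_eq_Max_positions:
  assumes "card (positions w x) = 1"
  shows "Min (positions w x) = Max (positions w x)"
  using assms by (auto simp: card_1_singleton_iff)

lemma positions_rev: "positions (rev w) x = (\<lambda>p. Suc (length w) - p) ` positions w x"
proof -
  \<comment> \<open>Stated for every \<open>v\<close>: reflection is an involution, so the case
    \<open>v = rev w\<close> yields the reverse inclusion.\<close>
  have *: "Suc (length v) - p \<in> positions (rev v) x" if "p \<in> positions v x" for v :: "nat list" and p
    using that by (auto simp: positions_def rev_nth)
  show ?thesis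
  proof
    show "(\<lambda>p. Suc (length w) - p) ` positions w x \<subseteq> positions (rev w) x" using * by auto
    show "positions (rev w) x \<subseteq> (\<lambda>p. Suc (length w) - p) ` positions w x"
    proof
      fix p assume p: "p \<in> positions (rev w) x"
      then have "p = Suc (length w) - (Suc (length w) - p)" by (auto simp: positions_def)
      then show "p \<in> (\<lambda>p. Suc (length w) - p) ` positions w x"
        using *[OF p] by auto
    qed
  qed
qed

lemma Min_positions_rev:
  assumes "x \<in> set w"
  shows "Min (positions (rev w) x) = Suc (length w) - Max (positions w x)"
  unfolding positions_rev
  using assms by (intro Min_eqI) (auto intro!: diff_le_mono2)

lemma Union_positions: "\<Union> (positions w ` set w) = {1..length w}"
  by (auto simp: positions_def)

text \<open>The position sets cover exactly \<open>{1..length w}\<close>, so they determine the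
  length, and then the letter at each position.\<close>

lemma word_eq_if_positions_eq:
  assumes "set w = set v" "\<And>x. x \<in> set w \<Longrightarrow> positions w x = positions v x"
  shows "w = v"
proof -
  have len: "length w = length v"
    using Union_positions[of w] Union_positions[of v] assms by auto
  show ?thesis
  proof (rule nth_equalityI[OF len])
    fix i assume "i < length w"
    then have "Suc i \<in> positions w (w ! i)" by (simp add: positions_def)
    also have "positions w (w ! i) = positions v (w ! i)"
      using \<open>i < length w\<close> by (intro assms) simp
    finally show "w ! i = v ! i" by (simp add: positions_def)
  qed
qed

section \<open>Binary search trees of words\<close>

text \<open>Facts about right insertion trees are derived from those about left ones through this
  reversal.\<close>

lemma P_rTg_conv_rev: "P_rTg w = P_lTg (rev w)"
  by (simp add: P_rTg_def P_lTg_def foldr_conv_fold)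

section \<open>Inserting one letter\<close>

lemma set_tree_insert_letter:
  "fst ` set_tree (insert_letter a t) = insert a (fst ` set_tree t)"
  by (induction a t rule: insert_letter.induct) auto

lemma bst_insert_letter:
  assumes "bst (map_tree fst t)"
  shows "bst (map_tree fst (insert_letter a t))"
  using assms
  by (induction a t rule: insert_letter.induct) (auto simp: set_tree_insert_letter tree.set_map)

lemma insert_letter_old:
  assumes "bst (map_tree fst t)" "a \<in> set_tree (map_tree fst t)"
  shows "map_tree fst (insert_letter a t) = map_tree fst t"
  using assms
  by (induction a t rule: insert_letter.induct) (auto dest: less_asym)

text \<open>The only possible new parent-child pair leads from an old node to a new leaf
  \<open>a\<close>, and every old label is related to \<open>a\<close>.\<close>

lemma parent_child_wrt_insert_letter:
  assumes "parent_child_wrt R (map_tree fst t)" "\<forall>b \<in> fst ` set_tree t. R b a"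
  shows "parent_child_wrt R (map_tree fst (insert_letter a t))"
proof -
  \<comment> \<open>The root label of a subtree changes only when an empty subtree is filled by
    \<open>a\<close>.\<close>
  have root: "b = a \<or> b \<in> root_label (map_tree fst t)"
    if "b \<in> root_label (map_tree fst (insert_letter a t))" for a b t
    using that by (induction a t rule: insert_letter.induct) (auto split: if_splits)
  show ?thesis
    using assms
    by (induction a t rule: insert_letter.induct) (auto dest!: root)
qed

text \<open>\<open>f\<close> gives the multiplicities before the insertion. An absent letter counts
  as 0, so its new leaf gets \<open>Suc (f a) = 1\<close>.\<close>

lemma insert_letter_mult:
  assumes "bst (map_tree fst t)" "\<forall>p \<in> set_tree t. snd p = f (fst p)"
    "a \<notin> fst ` set_tree t \<longrightarrow> f a = 0"
  shows "\<forall>p \<in> set_tree (insert_letter a t). snd p = (if fst p = a then Suc (f a) else f (fst p))"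
  using assms
proof (induction a t rule: insert_letter.induct)
  case (1 a)
  then show ?case by simp
next
  case (2 a l b m r)
  have l: "fst p < b" if "p \<in> set_tree l" for p using 2(3) that by (auto simp: tree.set_map)
  have r: "b < fst p" if "p \<in> set_tree r" for p using 2(3) that by (auto simp: tree.set_map)
  consider "a = b" | "a < b" | "b < a" by linarith
  then show ?case
  proof cases
    case 1
    then show ?thesis using 2(4) l r by auto
  next
    case lt: 2
    \<comment> \<open>With \<open>a\<close> absent from \<open>r\<close> and different from
      \<open>b\<close>, absence from \<open>l\<close> means absence from the whole tree; this passes
      the condition on \<open>f a = 0\<close> down to \<open>l\<close>.\<close>
    have "a \<notin> fst ` set_tree r" using r lt by (metis imageE less_asym)
    then have "\<forall>p \<in> set_tree (insert_letter a l).
        snd p = (if fst p = a then Suc (f a) else f (fst p))"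
      by (intro "2.IH"(1)) (use 2(3-5) lt \<open>a \<notin> _\<close> in auto)
    then show ?thesis using 2(4) lt by (auto dest: r)
  next
    case gt: 3
    have "a \<notin> fst ` set_tree l" using l gt by (metis imageE less_asym)
    then have "\<forall>p \<in> set_tree (insert_letter a r).
        snd p = (if fst p = a then Suc (f a) else f (fst p))"
      by (intro "2.IH"(2)) (use 2(3-5) gt \<open>a \<notin> _\<close> in auto)
    then show ?thesis using 2(4) gt by (auto dest: l)
  qed
qed

text \<open>A repeated letter changes neither the underlying search tree nor any first position. A
  new letter has the latest first position and enters as a leaf, so the heap order persists.\<close>

lemma P_lTg_tree:
  "bst (map_tree fst (P_lTg w)) \<and> fst ` set_tree (P_lTg w) = set w \<and>
   (\<forall>p \<in> set_tree (P_lTg w). snd p = count_list w (fst p)) \<and>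
   parent_child_wrt (<) (map_tree (\<lambda>x. Min (positions w x)) (map_tree fst (P_lTg w)))"
proof (induction w rule: rev_induct)
  case Nil
  then show ?case by (simp add: P_lTg_def)
next
  case (snoc a w)
  let ?t = "P_lTg w"
  \<comment> \<open>First positions in the longer word, as a relation on letters: it agrees with the
    old comparison on old letters and also covers a new \<open>a\<close>.\<close>
  let ?R = "\<lambda>x y. Min (positions (w @ [a]) x) < Min (positions (w @ [a]) y)"
  have ins: "P_lTg (w @ [a]) = insert_letter a ?t" by (simp add: P_lTg_def)
  have bst: "bst (map_tree fst ?t)" and set: "fst ` set_tree ?t = set w"
    and heap: "parent_child_wrt (<) (map_tree (\<lambda>x. Min (positions w x)) (map_tree fst ?t))"
    using snoc by auto
  have heap': "parent_child_wrt ?R (map_tree fst ?t)"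
    using parent_child_wrt_mono[OF heap, of ?R "\<lambda>x. x"] set Min_positions_snoc_old[of _ w a]
    by (simp add: tree.set_map tree.map_ident)
  have "parent_child_wrt ?R (map_tree fst (insert_letter a ?t))"
  proof (cases "a \<in> set w")
    case True
    then show ?thesis using heap' insert_letter_old[OF bst] set by (simp add: tree.set_map)
  next
    case False
    then have "\<forall>b \<in> fst ` set_tree ?t. ?R b a"
      using set Min_positions_le[of _ w]
      by (auto simp: Min_positions_snoc_old Min_positions_snoc_new less_Suc_eq_le)
    then show ?thesis using parent_child_wrt_insert_letter[OF heap'] by blast
  qed
  then have "parent_child_wrt (<)
      (map_tree (\<lambda>x. Min (positions (w @ [a]) x)) (map_tree fst (insert_letter a ?t)))"
    using parent_child_wrt_mono[where f = "\<lambda>x. x" and R = ?R] by (simp add: tree.map_ident)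
  then show ?case
    using bst_insert_letter[OF bst] insert_letter_mult[OF bst, of "count_list w" a] snoc
    by (simp add: ins set_tree_insert_letter count_list_0_iff)
qed

text \<open>A treap whose keys are the letters of \<open>w\<close> and whose priorities are given by
  \<open>f\<close>, with \<open>R\<close> fixing the direction of the heap order.\<close>

definition letter_tree :: "(nat \<Rightarrow> nat \<Rightarrow> bool) \<Rightarrow> (nat \<Rightarrow> nat) \<Rightarrow> nat list \<Rightarrow> nat tree \<Rightarrow> bool" where
  "letter_tree R f w t \<longleftrightarrow> bst t \<and> set_tree t = set w \<and> parent_child_wrt R (map_tree f t)"

abbreviation "left_letter_tree w \<equiv> letter_tree (<) (\<lambda>x. Min (positions w x)) w"
abbreviation "right_letter_tree w \<equiv> letter_tree (>) (\<lambda>x. Max (positions w x)) w"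

lemma letter_tree_inorder:
  assumes "letter_tree R f w t"
  shows "inorder t = sorted_list_of_set (set w)"
  using assms
  by (intro strict_sorted_equal) (simp_all add: letter_tree_def bst_iff_sorted_wrt_less)

text \<open>Reversing the word turns last positions into first positions and reverses their
  order.\<close>

lemma right_letter_tree_rev:
  "left_letter_tree (rev w) t \<longleftrightarrow> right_letter_tree w t"
proof -
  have *: "Min (positions (rev w) x) < Min (positions (rev w) y) \<longleftrightarrow>
      Max (positions w x) > Max (positions w y)" if "x \<in> set w" "y \<in> set w" for x y
  proof -
    have "Max (positions w x) \<in> positions w x" "Max (positions w y) \<in> positions w y"
      using that by (auto intro!: Max_in)
    \<comment> \<open>These bounds keep the truncated subtraction in
      \<open>Min_positions_rev\<close> strictly order-reversing.\<close>
    then have "Max (positions w x) \<le> length w" "Max (positions w y) \<le> length w"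
      unfolding positions_def[of w x] positions_def[of w y] by auto
    then show ?thesis
      unfolding Min_positions_rev[OF that(1)] Min_positions_rev[OF that(2)] by linarith
  qed
  have "parent_child_wrt (<) (map_tree (\<lambda>x. Min (positions (rev w) x)) t) \<longleftrightarrow>
      parent_child_wrt (>) (map_tree (\<lambda>x. Max (positions w x)) t)" if "set_tree t = set w"
  proof
    assume "parent_child_wrt (<) (map_tree (\<lambda>x. Min (positions (rev w) x)) t)"
    then show "parent_child_wrt (>) (map_tree (\<lambda>x. Max (positions w x)) t)"
      by (rule parent_child_wrt_mono) (simp only: * that)
  next
    assume "parent_child_wrt (>) (map_tree (\<lambda>x. Max (positions w x)) t)"
    then show "parent_child_wrt (<) (map_tree (\<lambda>x. Min (positions (rev w) x)) t)"
      by (rule parent_child_wrt_mono) (simp only: * that)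
  qed
  then show ?thesis by (auto simp: letter_tree_def)
qed

text \<open>The insertion tree, stripped of its multiplicities, is the witness.\<close>

lemma ex_left_letter_tree: "\<exists>t. left_letter_tree w t"
  using P_lTg_tree[of w] by (auto simp: letter_tree_def tree.set_map)

lemma ex_right_letter_tree: "\<exists>t. right_letter_tree w t"
  using ex_left_letter_tree[of "rev w"] by (simp add: right_letter_tree_rev)

text \<open>Stripped of multiplicities, \<open>P_lTg w\<close> is itself a left letter tree, hence
  equals \<open>t\<close> by uniqueness; \<open>count_list w\<close> restores the
  multiplicities.\<close>

lemma P_lTg_eq:
  assumes "left_letter_tree w t"
  shows "P_lTg w = map_tree (\<lambda>x. (x, count_list w x)) t"
proof -
  note P = P_lTg_tree[of w]
  have "map_tree fst (P_lTg w) = t"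
    using P assms by (intro bst_heap_unique) (auto simp: letter_tree_def tree.set_map)
  moreover have "map_tree (\<lambda>x. (x, count_list w x)) (map_tree fst (P_lTg w)) = map_tree (\<lambda>x. x) (P_lTg w)"
    using P unfolding tree.map_comp by (intro tree.map_cong) auto
  ultimately show ?thesis by (simp add: tree.map_ident)
qed

lemma P_rTg_eq:
  assumes "right_letter_tree w t"
  shows "P_rTg w = map_tree (\<lambda>x. (x, count_list w x)) t"
  using P_lTg_eq[of "rev w" t] assms by (simp add: P_rTg_conv_rev right_letter_tree_rev)

text \<open>Relabelled by first positions, \<open>t\<close> is heap-ordered with the same inorder
  list as the \<open>incr\<close> tree, so the two agree. Reading \<open>w\<close> at a first
  position then recovers the letter.\<close>

lemma Q_lTg_eq:
  assumes "left_letter_tree w t"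
  shows "Q_lTg w = map_tree (positions w) t"
proof -
  let ?f = "\<lambda>x. Min (positions w x)" and ?z = "sorted_list_of_set (set w)"
  have "distinct (map ?f ?z)" using inj_on_Min_positions by (simp add: distinct_map)
  then have "incr (map ?f ?z) = map_tree ?f t"
    using incr_heap[of "map ?f ?z"] assms
    by (intro heap_unique[where R = "(<)"])
      (auto simp: inorder_map letter_tree_inorder[OF assms] letter_tree_def intro: transpI asympI)
  then have "Q_lTg w = map_tree (\<lambda>x. positions w (w ! (?f x - 1))) t"
    by (simp add: Q_lTg_def position_labels_def tree.map_comp comp_def)
  also have "\<dots> = map_tree (positions w) t"
    using assms by (intro tree.map_cong) (auto simp: letter_tree_def nth_Min_positions simp del: One_nat_def)
  finally show ?thesis .
qed

lemma Q_rTg_eq: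
  assumes "right_letter_tree w t"
  shows "Q_rTg w = map_tree (positions w) t"
proof -
  let ?f = "\<lambda>x. Max (positions w x)" and ?z = "sorted_list_of_set (set w)"
  have "distinct (map ?f ?z)" using inj_on_Max_positions by (simp add: distinct_map)
  then have "decr (map ?f ?z) = map_tree ?f t"
    using decr_heap[of "map ?f ?z"] assms
    by (intro heap_unique[where R = "(>)"])
      (auto simp: inorder_map letter_tree_inorder[OF assms] letter_tree_def intro: transpI asympI)
  then have "Q_rTg w = map_tree (\<lambda>x. positions w (w ! (?f x - 1))) t"
    by (simp add: Q_rTg_def position_labels_def tree.map_comp comp_def)
  also have "\<dots> = map_tree (positions w) t"
    using assms by (intro tree.map_cong) (auto simp: letter_tree_def nth_Max_positions simp del: One_nat_def)
  finally show ?thesis .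
qed

section \<open>The correspondence\<close>

text \<open>An abbreviation, so that it is literally the set in the final theorem and no unfolding
  intervenes.\<close>

abbreviation mTg_pairs :: "((bstm \<times> bstm) \<times> bts \<times> bts) set" where
  "mTg_pairs \<equiv> {((TL, TR), (SL, SR)) | TL TR SL SR.
       twin_bstms TL TR \<and>
       twin_btss SL SR \<and> \<Union> (set_tree SL) = {1..sum_mult TL} \<and>
       underlying_shape TL = underlying_shape SL \<and> underlying_shape TR = underlying_shape SR \<and>
       (\<forall>i < size TL. snd (inorder TL ! i) = card (inorder SL ! i)) \<and>
       (\<forall>i < size TR. snd (inorder TR ! i) = card (inorder SR ! i))}"

section \<open>Words yield admissible pairs\<close>

lemma is_bstm_letter_tree:
  assumes "letter_tree R f w t" "w \<in> words"
  shows "is_bstm (map_tree (\<lambda>x. (x, count_list w x)) t)"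
proof -
  have "1 \<le> count_list w x" if "x \<in> set w" for x
    using that by (simp add: count_list_0_iff Suc_le_eq neq0_conv[symmetric] del: neq0_conv)
  then show ?thesis
    using assms
    by (auto simp: is_bstm_def is_btm_def shape_def letter_tree_def words_def tree.set_map
        tree.map_comp comp_def tree.map_ident)
qed

lemma is_bts_letter_tree:
  assumes "letter_tree R f w t"
  shows "is_bts (map_tree (positions w) t)"
proof -
  have t: "set_tree t = set w" "distinct (inorder t)"
    using assms letter_tree_inorder[OF assms] by (auto simp: letter_tree_def)
  have "positions w (inorder t ! i) \<inter> positions w (inorder t ! j) = {}"
    if "i < size t" "j < size t" "i \<noteq> j" for i j
  proof -
    have "inorder t ! i \<noteq> inorder t ! j" using that t(2) by (simp add: nth_eq_iff_index_eq)
    then show ?thesis by (auto simp: positions_def)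
  qed
  moreover have "positions w x \<subseteq> {1..}" for x by (auto simp: positions_def)
  ultimately show ?thesis using t(1) by (auto simp: is_bts_def tree.set_map inorder_map)
qed

lemma sum_mult_letter_tree:
  assumes "letter_tree R f w t"
  shows "sum_mult (map_tree (\<lambda>x. (x, count_list w x)) t) = length w"
  using sum_count_set[of w "set w"]
  by (simp add: sum_mult_def inorder_map comp_def letter_tree_inorder[OF assms]
      sum_list_distinct_conv_sum_set)

text \<open>All four trees are relabellings of the letter trees \<open>L\<close> and
  \<open>R\<close>, which share their inorder list, so each condition reduces to one on labels or on
  these two trees.\<close>

lemma mTg_in_pairs:
  assumes w: "w \<in> words"
  shows "(P_mTg w, Q_mTg w) \<in> mTg_pairs"
proof -
  obtain L R where L: "left_letter_tree w L" and R: "right_letter_tree w R"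
    using ex_left_letter_tree ex_right_letter_tree by blast
  have inorder: "inorder L = inorder R"
    using letter_tree_inorder[OF L] letter_tree_inorder[OF R] by simp
  have heaps: "parent_child_wrt (<) (map_tree (\<lambda>x. Min (positions w x)) L)"
    "parent_child_wrt (>) (map_tree (\<lambda>x. Max (positions w x)) R)"
    and set: "set_tree L = set w" "set_tree R = set w"
    using L R by (auto simp: letter_tree_def)
  \<comment> \<open>The label type stays general: \<open>g\<close> is instantiated with
    multiplicities and with position sets.\<close>
  have twin: "twin_wrt single (map_tree g L) (map_tree g R)"
    if "\<And>x. x \<in> set w \<Longrightarrow> single (g x) \<Longrightarrow> card (positions w x) = 1"
    for single and g :: "nat \<Rightarrow> 'b"
    using that set Min_le_Max_positions[of _ w] Min_eq_Max_positions[of w]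
    by (intro twin_wrt_map_tree[OF inorder heaps]) auto
  let ?TL = "P_lTg w" and ?TR = "P_rTg w" and ?SL = "Q_lTg w" and ?SR = "Q_rTg w"
  note eqs = P_lTg_eq[OF L] P_rTg_eq[OF R] Q_lTg_eq[OF L] Q_rTg_eq[OF R]
  have bstms: "is_bstm ?TL" "is_bstm ?TR"
    unfolding eqs using is_bstm_letter_tree L R w by blast+
  have "twin_wrt (\<lambda>m. m = 1) (shape ?TL) (shape ?TR)"
    unfolding eqs shape_def tree.map_comp by (intro twin) (simp add: card_positions)
  then have "twin_bstms ?TL ?TR"
    using bstms by (auto simp: twin_bstms_def twin_btms_def is_bstm_def eqs cont_def inorder_map inorder)
  moreover have "twin_btss ?SL ?SR"
    using is_bts_letter_tree[OF L] is_bts_letter_tree[OF R] heaps twin[of "\<lambda>X. card X = 1"]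
    unfolding eqs
    by (auto simp: twin_btss_def increasing_bts_def decreasing_bts_def tree.map_comp comp_def)
  moreover have "\<Union> (set_tree ?SL) = {1..sum_mult ?TL}"
    using Union_positions[of w] sum_mult_letter_tree[OF L] by (simp add: eqs tree.set_map set)
  moreover have "underlying_shape ?TL = underlying_shape ?SL"
    "underlying_shape ?TR = underlying_shape ?SR"
    "\<forall>i < size ?TL. snd (inorder ?TL ! i) = card (inorder ?SL ! i)"
    "\<forall>i < size ?TR. snd (inorder ?TR ! i) = card (inorder ?SR ! i)"
    by (simp_all add: eqs inorder_map card_positions)
  ultimately show ?thesis
    unfolding P_mTg_def Q_mTg_def by blast
qed

text \<open>The tree \<open>P_lTg w\<close> gives the letter at each node and \<open>Q_lTg w\<close>
  the positions of that letter; together they determine the word.\<close>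

lemma inj_mTg: "inj (\<lambda>w. (P_mTg w, Q_mTg w))"
proof (rule injI)
  fix w v assume eq: "(P_mTg w, Q_mTg w) = (P_mTg v, Q_mTg v)"
  obtain t u where t: "left_letter_tree w t" and u: "left_letter_tree v u"
    using ex_left_letter_tree by blast
  have "map_tree fst (P_lTg w) = map_tree fst (P_lTg v)" "Q_lTg w = Q_lTg v"
    using eq by (simp_all add: P_mTg_def Q_mTg_def)
  then have "t = u" and Q: "map_tree (positions w) t = map_tree (positions v) u"
    unfolding P_lTg_eq[OF t] P_lTg_eq[OF u] Q_lTg_eq[OF t] Q_lTg_eq[OF u]
    by (simp_all add: tree.map_comp comp_def tree.map_ident)
  then have "map (positions w) (inorder t) = map (positions v) (inorder t)"
    by (metis inorder_map)
  then have "\<forall>x \<in> set_tree t. positions w x = positions v x" by simp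
  then show "w = v"
    using t u \<open>t = u\<close> by (intro word_eq_if_positions_eq) (auto simp: letter_tree_def)
qed

text \<open>The sets partition \<open>{1..m}\<close>, so each position receives the letter of the
  block containing it. Nonempty blocks make every letter occur.\<close>

lemma ex_word_with_positions:
  assumes "distinct xs" "length Ss = length xs" "\<Union> (set Ss) = {1..m}" "{} \<notin> set Ss"
    and disj: "\<And>i j. i < length Ss \<Longrightarrow> j < length Ss \<Longrightarrow> i \<noteq> j \<Longrightarrow> Ss ! i \<inter> Ss ! j = {}"
  shows "\<exists>w. set w = set xs \<and> map (positions w) xs = Ss"
proof -
  have "\<exists>i < length Ss. p \<in> Ss ! i" if "p \<in> {1..m}" for p
    using that assms(3) by (metis UnionE in_set_conv_nth)
  \<comment> \<open>\<open>h p\<close> is the index of the block containing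
    \<open>p\<close>.\<close>
  then obtain h where h: "h p < length Ss" "p \<in> Ss ! h p" if "p \<in> {1..m}" for p
    by metis
  have h_eq: "h p = i" if "i < length Ss" "p \<in> Ss ! i" "p \<in> {1..m}" for p i
    using disj[of "h p" i] h[of p] that by auto
  define w where "w = map (\<lambda>p. xs ! h p) [1..<Suc m]"
  have len: "length w = m" by (simp add: w_def)
  have nth: "w ! (p - 1) = xs ! h p" if "p \<in> {1..m}" for p
    using that nth_map_upt[of "p - 1" "Suc m" 1 "\<lambda>p. xs ! h p"]
    by (auto simp: w_def simp del: upt_Suc)
  have pos: "positions w (xs ! i) = Ss ! i" if i: "i < length Ss" for i
  proof -
    have sub: "Ss ! i \<subseteq> {1..m}" using assms(3) nth_mem[OF i] by blast
    have "xs ! h p = xs ! i \<longleftrightarrow> p \<in> Ss ! i" if p: "p \<in> {1..m}" for p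
      using h[OF p] h_eq[OF i _ p] assms(1,2) i by (auto simp: nth_eq_iff_index_eq)
    then show ?thesis
      unfolding positions_def len using sub nth by auto
  qed
  have "set w \<subseteq> set xs"
    using h(1) assms(2) by (auto simp: w_def)
  moreover have "xs ! i \<in> set w" if "i < length xs" for i
  proof -
    have "Ss ! i \<in> set Ss" using that assms(2) by simp
    then have "positions w (xs ! i) \<noteq> {}"
      using pos[of i] that assms(2,4) by metis
    then show ?thesis by simp
  qed
  then have "set xs \<subseteq> set w" by (auto simp: in_set_conv_nth)
  moreover have "map (positions w) xs = Ss"
    using pos assms(2) by (intro nth_equalityI) auto
  ultimately show ?thesis by blast
qed

text \<open>Multiplicities are positive, so the value 0 of \<open>cont\<close> only marks absent
  letters and \<open>cont\<close> determines the set of node labels. The search order then fixes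
  their sequence.\<close>

lemma cont_eq_imp_inorder_eq:
  assumes T: "is_bstm T" and U: "is_bstm U" and cont: "cont T = cont U"
  shows "inorder T = inorder U"
proof -
  have in_iff: "(a, m) \<in> set_tree T \<longleftrightarrow> cont T a = m \<and> m \<noteq> 0" if "is_bstm T" for T a m
  proof -
    have "sorted_wrt (<) (map fst (inorder T))"
      using that by (simp add: is_bstm_def bst_iff_sorted_wrt_less inorder_map)
    then have "distinct (map fst (inorder T))"
      by (simp add: strict_sorted_iff)
    then have "(a, m) \<in> set_tree T \<longleftrightarrow> map_of (inorder T) a = Some m"
      by (metis map_of_eq_Some_iff set_inorder)
    moreover have "m \<noteq> 0" if "(a, m) \<in> set_tree T"
      using that \<open>is_bstm T\<close> by (force simp: is_bstm_def is_btm_def shape_def tree.set_map)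
    ultimately show ?thesis by (auto simp: cont_def split: option.splits)
  qed
  have "set_tree T = set_tree U"
    using in_iff[OF T] in_iff[OF U] cont by auto
  then have "set (map fst (inorder T)) = set (map fst (inorder U))" by simp
  moreover have sorted: "sorted_wrt (<) (map fst (inorder T))" "sorted_wrt (<) (map fst (inorder U))"
    using T U by (simp_all add: is_bstm_def bst_iff_sorted_wrt_less inorder_map)
  ultimately have "map fst (inorder T) = map fst (inorder U)"
    by (intro strict_sorted_equal) simp_all
  \<comment> \<open>A letter determines its multiplicity through \<open>cont\<close>, so equal lists
    of letters give equal lists of pairs.\<close>
  moreover have "inj_on fst (set_tree T \<union> set_tree U)"
    using \<open>set_tree T = set_tree U\<close> in_iff[OF U] by (force intro: inj_onI)
  ultimately show ?thesis
    by (intro map_inj_on[of fst]) simp_all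
qed

lemma map_tree_eqI:
  assumes "underlying_shape T = underlying_shape S"
    and "map f (inorder T) = inorder S"
  shows "map_tree f T = S"
  using assms by (simp add: tree_eq_if_shape_inorder inorder_map)

text \<open>The letters of \<open>TL\<close> and the sets of \<open>SL\<close>, matched in inorder,
  define the word; the given trees then turn out to be relabelled letter trees of that word.\<close>

lemma pairs_imp_mTg:
  assumes "((TL, TR), (SL, SR)) \<in> mTg_pairs"
  shows "\<exists>w \<in> words. (P_mTg w, Q_mTg w) = ((TL, TR), (SL, SR))"
proof -
  have T: "is_bstm TL" "is_bstm TR" "cont TL = cont TR"
    and S: "increasing_bts SL" "decreasing_bts SR" "twin_wrt (\<lambda>X. card X = 1) SL SR"
    and union: "\<Union> (set_tree SL) = {1..sum_mult TL}"
    and shapes: "underlying_shape TL = underlying_shape SL"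
      "underlying_shape TR = underlying_shape SR"
    and card: "\<forall>i < size TL. snd (inorder TL ! i) = card (inorder SL ! i)"
    using assms unfolding twin_bstms_def twin_btss_def mem_Collect_eq prod.inject by blast+
  define ps where "ps = inorder TL"
  define Ss where "Ss = inorder SL"
  have TR: "inorder TR = ps"
    using cont_eq_imp_inorder_eq[OF T] by (simp add: ps_def)
  have SR: "inorder SR = Ss"
  proof (rule nth_equalityI)
    show "length (inorder SR) = length Ss" using S(3) by (simp add: Ss_def twin_wrt_def)
    then show "inorder SR ! i = Ss ! i" if "i < length (inorder SR)" for i
      using S(3) that by (simp add: Ss_def twin_wrt_def)
  qed
  have len: "length Ss = length ps"
    using shapes(1) unfolding Ss_def ps_def
    by (metis length_inorder size_map_tree underlying_shape_def)
  have sorted: "sorted_wrt (<) (map fst ps)"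
    using T(1) by (simp add: is_bstm_def bst_iff_sorted_wrt_less inorder_map ps_def)
  have bts: "is_bts SL" using S(1) by (simp add: increasing_bts_def)
  have "\<exists>w. set w = set (map fst ps) \<and> map (positions w) (map fst ps) = Ss"
  proof (rule ex_word_with_positions)
    show "distinct (map fst ps)" using sorted by (simp add: strict_sorted_iff)
    show "\<Union> (set Ss) = {1..sum_mult TL}" using union by (simp add: Ss_def)
    show "{} \<notin> set Ss" using bts by (auto simp: is_bts_def Ss_def)
    show "Ss ! i \<inter> Ss ! j = {}" if "i < length Ss" "j < length Ss" "i \<noteq> j" for i j
      using bts that by (simp add: is_bts_def Ss_def)
  qed (use len in simp)
  then obtain w where w: "set w = set (map fst ps)" "map (positions w) (map fst ps) = Ss"
    by blast
  \<comment> \<open>Each multiplicity is the cardinality of a position set, which is a number of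
    occurrences by \<open>card_positions\<close>.\<close>
  have counts: "map (\<lambda>x. (x, count_list w x)) (map fst ps) = ps"
  proof (rule nth_equalityI)
    fix i assume "i < length (map (\<lambda>x. (x, count_list w x)) (map fst ps))"
    then have i: "i < length ps" by simp
    then have "snd (ps ! i) = card (Ss ! i)" using card by (simp add: ps_def Ss_def)
    also have "Ss ! i = positions w (fst (ps ! i))"
      using i by (simp flip: w(2))
    finally show "map (\<lambda>x. (x, count_list w x)) (map fst ps) ! i = ps ! i"
      using i by (simp add: card_positions prod_eq_iff)
  qed simp
  \<comment> \<open>As the shapes agree, these relabellings can be checked on inorder lists
    alone.\<close>
  have PQ: "map_tree (\<lambda>x. (x, count_list w x)) (map_tree fst TL) = TL"
    "map_tree (\<lambda>x. (x, count_list w x)) (map_tree fst TR) = TR"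
    "map_tree (positions w) (map_tree fst TL) = SL"
    "map_tree (positions w) (map_tree fst TR) = SR"
    unfolding tree.map_comp
    using counts w(2) shapes TR SR ps_def Ss_def
    by (auto intro!: map_tree_eqI simp: comp_def)
  have L: "left_letter_tree w (map_tree fst TL)"
  proof -
    \<comment> \<open>The minima of the sets in \<open>SL\<close> are now first positions in
      \<open>w\<close>, so the increasing condition is the heap order on letters.\<close>
    have "parent_child_wrt (<) (map_tree Min (map_tree (positions w) (map_tree fst TL)))"
      using S(1) by (simp only: PQ increasing_bts_def)
    then show ?thesis
      using T(1) w(1) by (simp add: letter_tree_def is_bstm_def tree.set_map tree.map_comp comp_def ps_def)
  qed
  have R: "right_letter_tree w (map_tree fst TR)"
  proof -
    have "set_tree TR = set_tree TL" using TR by (metis ps_def set_inorder)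
    moreover have "parent_child_wrt (>) (map_tree Max (map_tree (positions w) (map_tree fst TR)))"
      using S(2) by (simp only: PQ decreasing_bts_def)
    ultimately show ?thesis
      using T(2) w(1) by (simp add: letter_tree_def is_bstm_def tree.set_map tree.map_comp comp_def ps_def)
  qed
  have "(P_mTg w, Q_mTg w) = ((TL, TR), (SL, SR))"
    by (simp only: P_mTg_def Q_mTg_def P_lTg_eq[OF L] P_rTg_eq[OF R] Q_lTg_eq[OF L] Q_rTg_eq[OF R] PQ)
  moreover have "w \<in> words"
    using w(1) T(1) by (simp add: words_def is_bstm_def tree.set_map ps_def in_lists_conv_set subset_iff)
  ultimately show ?thesis by (rule bexI)
qed

theorem theorem4p17:
  shows "bij_betw (\<lambda>w. (P_mTg w, Q_mTg w)) words
    {((TL, TR), (SL, SR)) | TL TR SL SR.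
       twin_bstms TL TR \<and>
       twin_btss SL SR \<and> \<Union> (set_tree SL) = {1..sum_mult TL} \<and>
       underlying_shape TL = underlying_shape SL \<and> underlying_shape TR = underlying_shape SR \<and>
       (\<forall>i < size TL. snd (inorder TL ! i) = card (inorder SL ! i)) \<and>
       (\<forall>i < size TR. snd (inorder TR ! i) = card (inorder SR ! i))}"
proof (rule bij_betw_imageI)
  show "inj_on (\<lambda>w. (P_mTg w, Q_mTg w)) words"
    using inj_mTg by (rule inj_on_subset) simp
  show "(\<lambda>w. (P_mTg w, Q_mTg w)) ` words = mTg_pairs"
  proof (intro equalityI subsetI)
    fix q assume q: "q \<in> mTg_pairs"
    obtain TL TR SL SR where eq: "q = ((TL, TR), (SL, SR))" by (metis surj_pair)
    obtain w where "w \<in> words" "(P_mTg w, Q_mTg w) = q"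
      using pairs_imp_mTg[OF q[unfolded eq]] unfolding eq by blast
    then show "q \<in> (\<lambda>w. (P_mTg w, Q_mTg w)) ` words"
      by (intro image_eqI[of _ _ w]) simp_all
  next
    fix q assume "q \<in> (\<lambda>w. (P_mTg w, Q_mTg w)) ` words"
    then show "q \<in> mTg_pairs" using mTg_in_pairs by (elim imageE) (simp only:)
  qed
qed

end
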